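(* Let $p$ be a prime, $z\in\mathbb{F}_p^*$, and let $Z\in\mathbb{Z}$ be an integer whose residue mod $p$ is $z$. Then $\alpha(z,p)$ is the order of appearance of $p$ in the integer sequence $M_1(Z),M_2(Z),\dots,M_{p+1}(Z)$; that is, $\alpha(z,p)$ is the least positive integer $m$ such that $p$ divides $M_m(Z)$.
   Context: $\mathbb{F}$ is an algebraic closure of $\mathbb{F}_p$. For $x,y\in\mathbb{F}$, $[i,j]:=x^{p^i}y^{p^j}-x^{p^j}y^{p^i}$ and, for $x,y$ linearly independent over $\mathbb{F}_p$, $\nu(x,y):=-\frac{[0,2][1,3]}{[0,1][2,3]}$. For $m\ge1$, $\mathcal{Z}(m)=\{\nu(x,y):x,y\in\mathbb{F}_{p^m}\text{ lin. indep. over }\mathbb{F}_p\}$, $f_{m,p}(X)=\prod_{w\in\mathcal{Z}(m)\setminus\{0\}}(X-w)$; $\alpha(z,p)$ is the least $m\ge1$ with $f_{m,p}(z)=0$. The (Morgan-Voyce) polynomials $M_n(X)\in\mathbb{Z}[X]$ are defined by $M_0=0$, $M_1=1$, $M_n(X)=X\,M_{n-1}(X)+M_{n-2}(X)$ for odd $n\ge3$, and $M_n(X)=M_{n-1}(X)+M_{n-2}(X)$ for even $n\ge2$ (so $M_2=1$, $M_3=X+1$, $M_{2k+1}=b_k$, $M_{2k+2}=B_k$ in classical notation). *)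

theory Defs
  imports "HOL-Algebra.Algebraic_Closure_Type"
begin

text \<open>
  The field in which everything takes place is a type \<open>'a\<close>. Notions that the library
  formulates for explicit structures (subfields, linear independence, algebraic closures) are
  applied to \<open>ring_of_type_algebra\<close>, which is \<open>'a\<close> with its type class operations.
\<close>

text \<open>
  The image of the integers. In characteristic \<open>p > 0\<close> this is the prime subfield, i.e. the
  copy of the field with \<open>p\<close> elements inside \<open>'a\<close>.
\<close>
definition prime_field :: "'a :: field set" where
  "prime_field = range of_int"

text \<open>
  The subfield with \<open>q\<close> elements. If \<open>'a\<close> is algebraically closed of characteristic \<open>p\<close> and
  \<open>q = p ^ m\<close> with \<open>m \<ge> 1\<close>, it exists and is unique; see \<open>subfield_of_order\<close> below.
\<close>
definition subfield_of_order :: "nat \<Rightarrow> 'a :: field set" where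
  "subfield_of_order q = (THE K. subfield K (ring_of_type_algebra :: 'a ring) \<and> card K = q)"

text \<open>
  The library's linear independence of a list of vectors over a subfield; for a list of length two,
  see \<open>lin_indep_iff\<close> below.
\<close>
definition lin_indep :: "'a :: field \<Rightarrow> 'a \<Rightarrow> bool" where
  "lin_indep x y \<longleftrightarrow> ring.independent (ring_of_type_algebra :: 'a ring) prime_field [x, y]"

definition bracket :: "nat \<Rightarrow> nat \<Rightarrow> nat \<Rightarrow> 'a :: field \<Rightarrow> 'a \<Rightarrow> 'a" where
  "bracket p i j x y = x ^ (p ^ i) * y ^ (p ^ j) - x ^ (p ^ j) * y ^ (p ^ i)"

definition nu :: "nat \<Rightarrow> 'a :: field \<Rightarrow> 'a \<Rightarrow> 'a" where
  "nu p x y = - ((bracket p 0 2 x y * bracket p 1 3 x y) / (bracket p 0 1 x y * bracket p 2 3 x y))"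

definition Z_set :: "nat \<Rightarrow> nat \<Rightarrow> 'a :: field set" where
  "Z_set p m = {nu p x y | x y. x \<in> subfield_of_order (p ^ m) \<and> y \<in> subfield_of_order (p ^ m) \<and>
                              lin_indep x y}"

definition f_poly :: "nat \<Rightarrow> nat \<Rightarrow> 'a :: field poly" where
  "f_poly m p = (\<Prod>w\<in>Z_set p m - {0}. [:- w, 1:])"

definition alpha :: "'a :: field \<Rightarrow> nat \<Rightarrow> nat" where
  "alpha z p = (LEAST m. m \<ge> 1 \<and> poly (f_poly m p) z = 0)"

fun morgan_voyce :: "nat \<Rightarrow> int poly" where
  "morgan_voyce 0 = 0"
| "morgan_voyce (Suc 0) = 1"
| "morgan_voyce (Suc (Suc n)) =
     (if odd n then [:0, 1:] * morgan_voyce (Suc n) + morgan_voyce n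
      else morgan_voyce (Suc n) + morgan_voyce n)"


lemma carrier_rta [simp]: "carrier (ring_of_type_algebra :: 'a :: field ring) = UNIV"
  and zero_rta [simp]: "\<zero>\<^bsub>ring_of_type_algebra\<^esub> = (0 :: 'a)"
  and one_rta [simp]: "\<one>\<^bsub>ring_of_type_algebra\<^esub> = (1 :: 'a)"
  and add_rta [simp]: "x \<oplus>\<^bsub>ring_of_type_algebra\<^esub> y = (x + y :: 'a)"
  and mult_rta [simp]: "x \<otimes>\<^bsub>ring_of_type_algebra\<^esub> y = (x * y :: 'a)"
  by (simp_all add: ring_of_type_algebra_def)

lemma uminus_rta [simp]: "\<ominus>\<^bsub>ring_of_type_algebra\<^esub> x = (- x :: 'a :: field)"
proof -
  interpret field "ring_of_type_algebra :: 'a ring" by (rule field_from_type_algebra)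
  show ?thesis using minus_equality[of "- x" x] by simp
qed

lemma inv_rta [simp]: "x \<noteq> 0 \<Longrightarrow> inv\<^bsub>ring_of_type_algebra\<^esub> x = (inverse x :: 'a :: field)"
proof -
  interpret field "ring_of_type_algebra :: 'a ring" by (rule field_from_type_algebra)
  show "x \<noteq> 0 \<Longrightarrow> ?thesis" using comm_inv_char[of x "inverse x"] by simp
qed

lemma subfield_rta_iff:
  "subfield K (ring_of_type_algebra :: 'a :: field ring) \<longleftrightarrow>
     1 \<in> K \<and> (\<forall>x\<in>K. - x \<in> K) \<and> (\<forall>x\<in>K. \<forall>y\<in>K. x + y \<in> K) \<and>
     (\<forall>x\<in>K. \<forall>y\<in>K. x * y \<in> K) \<and> (\<forall>x\<in>K. x \<noteq> 0 \<longrightarrow> inverse x \<in> K)" (is "?l \<longleftrightarrow> ?r")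
proof -
  interpret field "ring_of_type_algebra :: 'a ring" by (rule field_from_type_algebra)
  show ?thesis
  proof
    assume l: ?l
    note s = subringE[OF subfieldE(1)[OF l]]
    have "inverse x \<in> K" if "x \<in> K" "x \<noteq> 0" for x
      using subfield_m_inv(1)[OF l, of x] that by auto
    with s show ?r by simp
  next
    assume ?r
    then show ?l by (intro subfieldI' subringI) auto
  qed
qed

lemma prime_field_subfield:
  assumes "prime p" "CHAR('a :: field) = p"
  shows "subfield prime_field (ring_of_type_algebra :: 'a ring)"
proof -
  have "inverse (of_int k :: 'a) \<in> range of_int" if k: "of_int k \<noteq> (0 :: 'a)" for k
  proof -
    have "\<not> int p dvd k" using k assms by (simp add: of_int_eq_0_iff_char_dvd)
    hence "coprime k (int p)" using assms(1) prime_imp_coprime[of "int p" k] by (simp add: coprime_commute)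
    then obtain u v where "u * k + v * int p = 1"
      using bezout_int[of k "int p"] by auto
    hence "(of_int (u * k + v * int p) :: 'a) = 1" by simp
    moreover have "(of_nat p :: 'a) = 0" using assms(2) of_nat_CHAR by metis
    ultimately have "of_int u * of_int k = (1 :: 'a)" by simp
    hence "inverse (of_int k :: 'a) = of_int u" by (metis inverse_unique mult.commute)
    thus ?thesis by simp
  qed
  moreover have "1 \<in> range (of_int :: int \<Rightarrow> 'a)" by (rule range_eqI[of _ _ 1]) simp
  ultimately show ?thesis
    unfolding subfield_rta_iff prime_field_def
    by (auto simp flip: of_int_minus of_int_add of_int_mult)
qed

lemma lin_indep_iff:
  assumes "prime p" "CHAR('a :: field) = p"
  shows "lin_indep x (y :: 'a) \<longleftrightarrow>
           (\<forall>a\<in>prime_field. \<forall>b\<in>prime_field. a * x + b * y = 0 \<longrightarrow> a = 0 \<and> b = 0)"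
    (is "_ = ?r")
proof -
  interpret field "ring_of_type_algebra :: 'a ring" by (rule field_from_type_algebra)
  note K = prime_field_subfield[OF assms, unfolded subfield_rta_iff]
  have K0: "(0 :: 'a) \<in> prime_field" unfolding prime_field_def by (rule range_eqI[of _ _ 0]) simp
  have "lin_indep x y \<longleftrightarrow> y \<noteq> 0 \<and> (\<forall>k\<in>prime_field. x \<noteq> k * y)"
  proof -
    have S: "Span prime_field [y] = {k * y | k. k \<in> prime_field}"
      by (auto simp: line_extension_mem_iff)
    have "independent prime_field [x, y] \<longleftrightarrow> x \<notin> Span prime_field [y] \<and> y \<notin> Span prime_field []"
      by (auto intro!: li_Cons dest: independent_backwards simp del: Span.simps)
    thus ?thesis unfolding lin_indep_def S by auto
  qed
  also have "\<dots> \<longleftrightarrow> ?r"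
  proof
    assume l: "y \<noteq> 0 \<and> (\<forall>k\<in>prime_field. x \<noteq> k * y)"
    show ?r
    proof (intro ballI impI)
      fix a b :: 'a assume ab: "a \<in> prime_field" "b \<in> prime_field" "a * x + b * y = 0"
      have "a = 0"
      proof (rule ccontr)
        assume a: "a \<noteq> 0"
        hence "x = (- b * inverse a) * y"
          using ab(3) by (simp add: field_simps eq_neg_iff_add_eq_0)
        moreover have "- b * inverse a \<in> prime_field" using K ab a by blast
        ultimately show False using l by blast
      qed
      thus "a = 0 \<and> b = 0" using ab l by simp
    qed
  next
    assume r: ?r
    have "x \<noteq> k * y" if "k \<in> prime_field" for k
    proof
      assume "x = k * y"
      hence "1 * x + (- k) * y = 0" by simp
      moreover have "- k \<in> prime_field" "(1 :: 'a) \<in> prime_field" using K that by simp_all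
      ultimately have "1 = (0 :: 'a)" using r by blast
      thus False by simp
    qed
    moreover have "y \<noteq> 0"
    proof
      assume "y = 0"
      hence "0 * x + 1 * y = 0" by simp
      moreover have "(1 :: 'a) \<in> prime_field" using K by blast
      ultimately have "1 = (0 :: 'a)" using r K0 by blast
      thus False by simp
    qed
    ultimately show "y \<noteq> 0 \<and> (\<forall>k\<in>prime_field. x \<noteq> k * y)" by blast
  qed
  finally show ?thesis .
qed

lemma subfield_power_card:
  assumes K: "subfield K (ring_of_type_algebra :: 'a :: field ring)" "finite K" and x: "x \<in> K"
  shows "x ^ card K = x"
proof (cases "x = 0")
  case False
  note K' = K(1)[unfolded subfield_rta_iff]
  have 0: "0 \<in> K" using K' by (metis add.right_inverse)
  have nz: "\<Prod>(K - {0}) \<noteq> 0" using K(2) by simp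
  have inv: "inverse x \<in> K" using K' x False by blast
  have "(\<Prod>y\<in>K - {0}. x * y) = \<Prod>(K - {0})"
    by (rule prod.reindex_bij_witness[of _ "\<lambda>y. inverse x * y" "\<lambda>y. x * y"])
       (use False K' x inv in auto)
  hence "x ^ card (K - {0}) * \<Prod>(K - {0}) = \<Prod>(K - {0})" by (simp add: prod.distrib)
  hence "x ^ card (K - {0}) = 1" using nz by simp
  moreover have "card K = Suc (card (K - {0}))" using card.remove[OF K(2) 0] .
  ultimately show ?thesis by simp
next
  case True
  thus ?thesis using K(2) x by (auto simp: card_gt_0_iff)
qed

lemma card_power_fixed:
  assumes "prime p" "CHAR('a :: alg_closed_field) = p" "m \<ge> 1"
  shows "card {x :: 'a. x ^ (p ^ m) = x} = p ^ m"
proof -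
  define q where "q = p ^ m"
  define P :: "'a poly" where "P = Polynomial.monom 1 q - [:0, 1:]"
  have q: "q > 1" using assms unfolding q_def
    by (metis One_nat_def not_one_le_zero one_less_power prime_gt_1_nat bot_nat_0.not_eq_extremum)
  have c: "Polynomial.coeff P q = 1" using q by (auto simp: P_def coeff_pCons split: nat.split)
  have "Polynomial.degree P \<le> q" unfolding P_def using q
    by (intro degree_diff_le) (auto simp: degree_monom_le)
  with c have deg: "Polynomial.degree P = q"
    by (metis le_antisym le_degree zero_neq_one)
  have P0: "P \<noteq> 0" using c by auto
  have "(of_nat q :: 'a) = 0" using assms unfolding q_def
    by (simp add: of_nat_eq_0_iff_char_dvd)
  hence "pderiv P = - 1" by (simp add: P_def pderiv_diff pderiv_monom pderiv_pCons one_pCons)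
  hence nd: "poly (pderiv P) x \<noteq> 0" for x by simp
  obtain A where A: "size A = q" "P = (\<Prod>x\<in>#A. [:- x, 1:])"
    using alg_closed_imp_factorization[OF P0] deg c by auto
  have "count A x \<le> 1" for x
  proof (rule ccontr)
    assume "\<not> ?thesis"
    hence "x \<in># A" and "x \<in># A - {#x#}"
      by (auto simp: in_diff_count intro: count_inI)
    then obtain B where "A = add_mset x (add_mset x B)"
      by (metis insert_DiffM)
    hence P: "P = [:- x, 1:] * ([:- x, 1:] * (\<Prod>x\<in>#B. [:- x, 1:]))" using A by simp
    have "poly (pderiv P) x = 0" unfolding P pderiv_mult by simp
    thus False using nd by blast
  qed
  hence A': "A = mset_set (set_mset A)"
    by (intro multiset_eqI) (simp add: count_mset_set' not_in_iff le_antisym Suc_leI)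
  have "poly P x = 0 \<longleftrightarrow> x \<in># A" for x
  proof -
    have "poly P x = (\<Prod>y\<in>#A. x - y)"
      unfolding A(2) by (simp add: poly_prod_mset multiset.map_comp o_def)
    thus ?thesis by (auto simp: prod_mset_zero_iff)
  qed
  moreover have "poly P x = x ^ q - x" for x by (simp add: P_def poly_monom)
  ultimately have "{x. x ^ q = x} = set_mset A" by auto
  moreover have "card (set_mset A) = q" using A(1) A' by (metis size_mset_set)
  ultimately show ?thesis by (simp add: q_def)
qed

lemma subfield_of_order:
  assumes "prime p" "CHAR('a :: alg_closed_field) = p" "m \<ge> 1"
  shows subfield_of_order_eq: "subfield_of_order (p ^ m) = {x :: 'a. x ^ (p ^ m) = x}"
    and subfield_of_order_ex1:
      "\<exists>!K. subfield K (ring_of_type_algebra :: 'a ring) \<and> card K = p ^ m"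
proof -
  define q where "q = p ^ m"
  have q: "q > 0" using assms(1) by (simp add: q_def prime_gt_0_nat)
  let ?K = "{x :: 'a. x ^ q = x}"
  have card: "card ?K = q" unfolding q_def by (rule card_power_fixed[OF assms])
  hence fin: "finite ?K" using q card_ge_0_finite by metis
  have add: "(x + y) ^ q = x ^ q + y ^ q" for x y :: 'a
    using freshmans_dream'[where ?'a = 'a, of q m x y] assms by (simp add: q_def)
  have neg: "(- x) ^ q = - (x ^ q)" for x :: 'a
    using add[of x "- x"] q by (simp add: power_0_left eq_neg_iff_add_eq_0 add.commute)
  have sub: "subfield ?K (ring_of_type_algebra :: 'a ring)"
    unfolding subfield_rta_iff by (auto simp: add neg power_mult_distrib power_inverse)
  have uniq: "K = ?K" if K: "subfield K (ring_of_type_algebra :: 'a ring)" "card K = q" for K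
  proof -
    have "finite K" using K(2) q card_ge_0_finite by metis
    hence "K \<subseteq> ?K" using subfield_power_card[OF K(1)] K(2) by auto
    thus ?thesis using card_subset_eq[OF fin] card K(2) by auto
  qed
  show "\<exists>!K. subfield K (ring_of_type_algebra :: 'a ring) \<and> card K = p ^ m"
    using sub card uniq unfolding q_def by blast
  show "subfield_of_order (p ^ m) = {x :: 'a. x ^ (p ^ m) = x}"
    unfolding subfield_of_order_def
    by (rule the1_equality[OF \<open>\<exists>!K. _\<close>]) (use sub card in \<open>simp add: q_def\<close>)
qed

end

theory Submission
  imports Defs
begin

text \<open>
  The invariant \<open>\<nu>\<close> is homogeneous of degree \<open>0\<close>, so only \<open>r = x / y\<close> matters, and
  \<open>r\<close> lies in the field with \<open>p ^ m\<close> elements iff \<open>D\<^sub>m = r - r ^ p ^ m\<close> vanishes. The \<open>D\<^sub>n\<close>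
  satisfy a three-term recurrence whose coefficients are Frobenius twists of each other; if
  \<open>\<nu> = z\<close> is a nonzero element of the prime field, rescaling \<open>D\<^sub>n\<close> by suitable nonzero factors turns
  this recurrence into that of \<open>M\<^sub>n(z)\<close>. Hence \<open>z\<close> lies in \<open>\<Z>(m)\<close> iff \<open>M\<^sub>m(z) = 0\<close>. For the bound
  \<open>p + 1\<close>, put \<open>s\<^sup>2 = z\<close>: up to a factor \<open>s\<close> at even \<open>n\<close>, \<open>M\<^sub>n(z)\<close> is the Lucas sequence
  \<open>(\<tau>\<^sup>n - \<sigma>\<^sup>n) / (\<tau> - \<sigma>)\<close> with \<open>\<tau> + \<sigma> = s\<close>, \<open>\<tau> \<sigma> = -1\<close>, and up to sign the Frobenius map
  fixes or swaps \<open>\<tau>\<close> and \<open>\<sigma>\<close>.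
\<close>

section \<open>Frobenius and the prime field\<close>

lemma frobenius_add:
  fixes x y :: "'a :: field"
  assumes "prime p" "CHAR('a) = p"
  shows "(x + y) ^ (p ^ n) = x ^ (p ^ n) + y ^ (p ^ n)"
  using freshmans_dream'[where ?'a = 'a, of "p ^ n" n x y] assms by simp

lemma frobenius_diff:
  fixes x y :: "'a :: field"
  assumes "prime p" "CHAR('a) = p"
  shows "(x - y) ^ (p ^ n) = x ^ (p ^ n) - y ^ (p ^ n)"
  using frobenius_add[OF assms, of "x - y" y n] by (simp add: eq_diff_eq)

lemma frobenius_minus:
  fixes x :: "'a :: field"
  assumes "prime p" "CHAR('a) = p"
  shows "(- x) ^ (p ^ n) = - (x ^ (p ^ n))"
  using frobenius_diff[OF assms, of 0 x n] prime_gt_0_nat[OF assms(1)] by (simp add: power_0_left)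

lemma frobenius_fixed_power:
  fixes x :: "'a :: field"
  assumes "x ^ p = x"
  shows "x ^ (p ^ n) = x"
  by (induction n) (simp_all add: assms power_mult)

text \<open>Fermat's little theorem: additivity of Frobenius gives it for naturals by induction, and
  negation extends it to all integers.\<close>

lemma prime_field_frobenius:
  fixes a :: "'a :: field"
  assumes "prime p" "CHAR('a) = p" "a \<in> prime_field"
  shows "a ^ p = a"
proof -
  have nat: "(of_nat k :: 'a) ^ p = of_nat k" for k
    using frobenius_add[OF assms(1,2), of _ _ 1] prime_gt_0_nat[OF assms(1)]
    by (induction k) (simp_all add: power_0_left)
  obtain k where k: "a = of_int k" using assms(3) by (auto simp: prime_field_def)
  show ?thesis
  proof (cases k)
    case (nonneg n)
    thus ?thesis using k nat by simp
  next
    case (neg n)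
    hence "a = - of_nat (Suc n)" using k by simp
    thus ?thesis using frobenius_minus[OF assms(1,2), of "of_nat (Suc n)" 1] nat[of "Suc n"]
      by (metis power_one_right)
  qed
qed

section \<open>Homogeneity of \<open>nu\<close>\<close>

lemma bracket_ratio:
  fixes x y :: "'a :: field"
  assumes "y \<noteq> 0"
  shows "bracket p i j x y = y ^ (p ^ i + p ^ j) * bracket p i j (x / y) 1"
  using assms by (simp add: bracket_def field_simps power_add)

lemma nu_ratio:
  fixes x y :: "'a :: field"
  assumes "y \<noteq> 0"
  shows "nu p x y = nu p (x / y) 1"
  unfolding nu_def bracket_ratio[OF assms, of p _ _ x]
  using assms by (simp add: power_add mult_ac)

text \<open>At \<open>y = 0\<close> a bracket in the numerator vanishes. This licenses passing to
  the ratio \<open>x / y\<close>.\<close>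

lemma nu_nonzero_imp_right_nonzero:
  fixes x y :: "'a :: field"
  assumes "nu p x y \<noteq> 0"
  shows "y \<noteq> 0"
  using assms by (cases "p = 0") (auto simp: nu_def bracket_def power_0_left)

section \<open>Morgan-Voyce values as a criterion for Frobenius-fixed points\<close>

definition mv_coeff :: "'a :: field \<Rightarrow> nat \<Rightarrow> 'a" where
  "mv_coeff z n = (if odd n then z else 1)"

definition mv :: "int \<Rightarrow> nat \<Rightarrow> 'a :: field" where
  "mv Z n = of_int (poly (morgan_voyce n) Z)"

lemma mv_simps [simp]:
  "mv Z 0 = 0" "mv Z (Suc 0) = 1"
  "mv Z (Suc (Suc n)) = mv_coeff (of_int Z) n * mv Z (Suc n) + mv Z n"
  by (simp_all add: mv_def mv_coeff_def)

lemma mv_coeff_Suc: "mv_coeff z n * mv_coeff z (Suc n) = z"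
  by (simp add: mv_coeff_def)

lemma mv_eq_0_iff:
  assumes "CHAR('a :: field) = p"
  shows "(mv Z n :: 'a) = 0 \<longleftrightarrow> int p dvd poly (morgan_voyce n) Z"
  using assms by (simp add: mv_def of_int_eq_0_iff_char_dvd)

lemma mv_coeff_nonzero: "z \<noteq> 0 \<Longrightarrow> mv_coeff z n \<noteq> 0"
  by (simp add: mv_coeff_def)

lemma fixed_iff_mv_eq_0:
  fixes r z :: "'a :: field"
  assumes p: "prime p" "CHAR('a) = p"
    and z: "z ^ p = z" "z \<noteq> 0" "of_int Z = z" and nu: "nu p r 1 = z"
  shows "r ^ (p ^ n) = r \<longleftrightarrow> (mv Z n :: 'a) = 0"
proof -
  define D where "D n = r - r ^ (p ^ n)" for n
  define g where "g n = (r - r ^ p) ^ (p ^ n)" for n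
  have g_eq: "g n = r ^ (p ^ n) - r ^ (p ^ Suc n)" for n
    unfolding g_def using frobenius_diff[OF p, of r "r ^ p" n] by (simp add: power_mult)
  have D_Suc: "D (Suc n) = D n + g n" for n
    by (simp add: D_def g_eq)
  have g_power: "g (i + n) = g i ^ (p ^ n)" for i n
    unfolding g_def by (simp add: power_add power_mult)
  \<comment> \<open>For \<open>i < j\<close>, \<open>bracket p i j r 1\<close> telescopes to
    \<open>g i + ... + g (j - 1)\<close>.\<close>
  have "nu p r 1 = - ((g 0 + g 1) * (g 1 + g 2) / (g 0 * g 2))"
    by (simp add: nu_def bracket_def g_eq eval_nat_numeral)
  hence nu': "- ((g 0 + g 1) * (g 1 + g 2) / (g 0 * g 2)) = z" using nu by simp
  \<comment> \<open>Since \<open>x / 0 = 0\<close>, \<open>z \<noteq> 0\<close> also rules out vanishing denominators.\<close>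
  hence nz: "g 0 \<noteq> 0" "g 0 + g 1 \<noteq> 0" using z(2) by auto
  have gnz: "g n \<noteq> 0" for n using g_power[of 0 n] nz by simp
  have rel0: "(g 0 + g 1) * (g 1 + g 2) = - (z * (g 0 * g 2))"
    using gnz[of 0] gnz[of 2] by (simp flip: nu')
  \<comment> \<open>Apply the \<open>n\<close>-th Frobenius power to \<open>rel0\<close>; it shifts
    every index of \<open>g\<close> by \<open>n\<close> and fixes \<open>z\<close>.\<close>
  have rel: "(g n + g (Suc n)) * (g (Suc n) + g (Suc (Suc n))) = - (z * (g n * g (Suc (Suc n))))" for n
    using arg_cong[OF rel0, of "\<lambda>a. a ^ (p ^ n)"] g_power[of 0 n] g_power[of 1 n] g_power[of 2 n]
      frobenius_fixed_power[OF z(1), of n]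
    by (simp add: power_mult_distrib frobenius_add[OF p] frobenius_minus[OF p])
  text \<open>
    From \<open>D\<^sub>n\<^sub>+\<^sub>2 = (1 + w\<^sub>n) D\<^sub>n\<^sub>+\<^sub>1 - w\<^sub>n D\<^sub>n\<close> with \<open>w\<^sub>n = g\<^sub>n\<^sub>+\<^sub>1 / g\<^sub>n\<close>, scaling factors
    \<open>s\<^sub>n\<close> with \<open>D\<^sub>n = s\<^sub>n M\<^sub>n\<close> must satisfy \<open>s\<^sub>n\<^sub>+\<^sub>2 = - w\<^sub>n s\<^sub>n\<close> and the last conjunct below; \<open>rel\<close>
    makes the two compatible.
  \<close>
  have "\<exists>s t. s \<noteq> 0 \<and> t \<noteq> 0 \<and> D n = s * mv Z n \<and> D (Suc n) = t * mv Z (Suc n) \<and>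
          (g n + g (Suc n)) * t = - (g (Suc n) * mv_coeff z n * s)" for n
  proof (induction n)
    case 0
    \<comment> \<open>\<open>D 1 = g 0\<close> forces \<open>t\<close>. As \<open>D 0 = 0\<close>
      leaves \<open>s\<close> free, it is solved from the last conjunct.\<close>
    have "D 0 = 0" by (simp add: D_def)
    thus ?case
      by (intro exI[of _ "- ((g 0 + g 1) * g 0 / g 1)"] exI[of _ "g 0"])
         (use nz gnz[of 1] in \<open>simp add: D_Suc mv_coeff_def\<close>)
  next
    case (Suc n)
    then obtain s t where st: "s \<noteq> 0" "t \<noteq> 0" "D n = s * mv Z n" "D (Suc n) = t * mv Z (Suc n)"
      and inv: "(g n + g (Suc n)) * t = - (g (Suc n) * mv_coeff z n * s)" by blast
    define s' where "s' = - (g (Suc n) * s) / g n"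
    have gs': "g n * s' = - (g (Suc n) * s)" using gnz[of n] by (simp add: s'_def)
    have "g n * D (Suc (Suc n)) = (g n + g (Suc n)) * D (Suc n) - g (Suc n) * D n"
      by (simp add: D_Suc algebra_simps)
    also have "\<dots> = ((g n + g (Suc n)) * t) * mv Z (Suc n) - g (Suc n) * (s * mv Z n)"
      by (simp add: st)
    also have "\<dots> = (g n * s') * mv Z (Suc (Suc n))"
      unfolding inv gs' by (simp add: z algebra_simps)
    finally have D2: "D (Suc (Suc n)) = s' * mv Z (Suc (Suc n))" using gnz[of n]
      by (simp add: mult.assoc del: mv_simps)
    let ?e = "mv_coeff z n"
    have "g n * ?e * ((g (Suc n) + g (Suc (Suc n))) * s')
            = (g (Suc n) + g (Suc (Suc n))) * ?e * (g n * s')" by (simp add: mult_ac)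
    also have "\<dots> = (g (Suc n) + g (Suc (Suc n))) * - (g (Suc n) * ?e * s)"
      unfolding gs' by (simp add: algebra_simps)
    also have "\<dots> = ((g n + g (Suc n)) * (g (Suc n) + g (Suc (Suc n)))) * t"
      unfolding inv[symmetric] by (simp add: mult_ac)
    \<comment> \<open>The factor \<open>z\<close> in \<open>rel\<close> splits into two consecutive
      coefficients, which is why the alternating recurrence fits.\<close>
    also have "\<dots> = - (?e * mv_coeff z (Suc n) * (g n * g (Suc (Suc n)))) * t"
      unfolding rel mv_coeff_Suc ..
    also have "\<dots> = g n * ?e * - (g (Suc (Suc n)) * mv_coeff z (Suc n) * t)"
      by (simp add: algebra_simps)
    finally have "g n * ?e * ((g (Suc n) + g (Suc (Suc n))) * s') =
        g n * ?e * - (g (Suc (Suc n)) * mv_coeff z (Suc n) * t)" .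
    hence "(g (Suc n) + g (Suc (Suc n))) * s' = - (g (Suc (Suc n)) * mv_coeff z (Suc n) * t)"
      using gnz[of n] mv_coeff_nonzero[OF z(2), of n]
      by (simp only: mult_cancel_left mult_eq_0_iff simp_thms)
    moreover have "s' \<noteq> 0" using st gnz by (simp add: s'_def)
    ultimately show ?case using st D2 by blast
  qed
  then obtain s where "s \<noteq> 0" "D n = s * mv Z n" by blast
  thus ?thesis by (auto simp: D_def)
qed

section \<open>Membership in \<open>Z_set\<close> and roots of \<open>f_poly\<close>\<close>

lemma lin_indep_1:
  fixes r :: "'a :: field"
  assumes p: "prime p" "CHAR('a) = p" and r: "r ^ p \<noteq> r"
  shows "lin_indep r 1"
  unfolding lin_indep_iff[OF p]
proof (intro ballI impI)
  fix a b :: 'a assume ab: "a \<in> prime_field" "b \<in> prime_field" "a * r + b * 1 = 0"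
  \<comment> \<open>Otherwise \<open>r\<close> is a quotient of prime field elements, hence fixed by
    Frobenius.\<close>
  have "a = 0"
  proof (rule ccontr)
    assume a: "a \<noteq> 0"
    hence "r = - (b / a)" using ab(3) by (simp add: field_simps eq_neg_iff_add_eq_0)
    thus False using r prime_field_frobenius[OF p ab(1)] prime_field_frobenius[OF p ab(2)]
        frobenius_minus[OF p, of "b / a" 1] by (simp add: power_divide)
  qed
  thus "a = 0 \<and> b = 0" using ab by simp
qed

text \<open>With \<open>u = r - r ^ p\<close> and \<open>v = u ^ (p - 1)\<close>, the value
  \<open>nu p r 1\<close> becomes \<open>- (1 + v) ^ (p + 1) / v ^ p\<close>. So one solves
  successively for \<open>v\<close>, \<open>u\<close> and \<open>r\<close>.\<close>

lemma nu_attained: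
  fixes z :: "'a :: alg_closed_field"
  assumes p: "prime p" "CHAR('a) = p"
  obtains r where "r ^ p \<noteq> r" "nu p r 1 = z"
proof -
  have p1: "p > 1" using p(1) by (rule prime_gt_1_nat)
  define P :: "'a poly" where "P = [:1, 1:] ^ (p + 1) + Polynomial.monom z p"
  have "Polynomial.degree ([:1, 1 :: 'a:] ^ (p + 1)) = p + 1"
    by (simp only: degree_linear_power)
  moreover have "Polynomial.degree (Polynomial.monom z p) < p + 1"
    using degree_monom_le[of z p] by simp
  ultimately have "Polynomial.degree P = p + 1"
    unfolding P_def by (metis degree_add_eq_left)
  then obtain v where "poly P v = 0" using alg_closed_imp_poly_has_root[of P] by auto
  hence v: "(1 + v) ^ (p + 1) = - (z * v ^ p)"
    by (simp add: P_def poly_monom eq_neg_iff_add_eq_0 add.commute distrib_right)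
  have v0: "v \<noteq> 0"
  proof
    assume "v = 0"
    thus False using v p1 by (simp add: power_0_left)
  qed
  obtain u where u: "u ^ (p - 1) = v" using nth_root_exists[of "p - 1" v] p1 by auto
  hence u0: "u \<noteq> 0" using v0 p1 by (auto simp: power_0_left)
  \<comment> \<open>An Artin-Schreier polynomial.\<close>
  define Q :: "'a poly" where "Q = Polynomial.monom 1 p + [:u, - 1:]"
  have "Polynomial.degree Q = p" unfolding Q_def
    using p1 by (subst degree_add_eq_left) (auto simp: degree_monom_eq)
  then obtain r where "poly Q r = 0" using alg_closed_imp_poly_has_root[of Q] p1 by auto
  hence r: "r - r ^ p = u" by (simp add: Q_def poly_monom algebra_simps)
  define g where "g n = u ^ (p ^ n)" for n
  have g_eq: "g n = r ^ (p ^ n) - r ^ (p ^ Suc n)" for n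
    unfolding g_def using frobenius_diff[OF p, of r "r ^ p" n] r by (simp add: power_mult)
  have up: "u ^ p = u * v" using p1 u by (metis One_nat_def Suc_pred' less_trans power_Suc zero_less_one)
  have g: "g 0 = u" "g (Suc 0) = u * v" "g 2 = u * v * v ^ p"
    by (simp_all add: g_def power2_eq_square power_mult up power_mult_distrib)
  have fr: "(1 + v) ^ p = 1 + v ^ p" using frobenius_add[OF p, of 1 v 1] by simp
  have "nu p r 1 = - ((g 0 + g 1) * (g 1 + g 2) / (g 0 * g 2))"
    by (simp add: nu_def bracket_def g_eq eval_nat_numeral)
  also have "(g 0 + g 1) * (g 1 + g 2) = u * u * v * (1 + v) ^ (p + 1)"
    by (simp add: g fr algebra_simps)
  also have "\<dots> = - z * (g 0 * g 2)" unfolding v by (simp add: g)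
  finally have "nu p r 1 = z" using u0 v0 by (simp add: g)
  moreover have "r ^ p \<noteq> r" using r u0 by auto
  ultimately show ?thesis using that by blast
qed

text \<open>The fixed-point criterion depends on \<open>z\<close> alone, not on the chosen ratio, so
  for the converse a single \<open>r\<close> with value \<open>z\<close> suffices.\<close>

lemma mem_Z_set_iff:
  fixes z :: "'a :: alg_closed_field"
  assumes p: "prime p" "CHAR('a) = p" and m: "m \<ge> 1"
    and z: "z \<in> prime_field" "z \<noteq> 0" "of_int Z = z"
  shows "z \<in> Z_set p m \<longleftrightarrow> (mv Z m :: 'a) = 0"
proof
  note zp = prime_field_frobenius[OF p z(1)]
  note K = subfield_of_order_eq[OF p m]
  {
    assume "z \<in> Z_set p m"
    then obtain x y where xy: "z = nu p x y" "x ^ (p ^ m) = x" "y ^ (p ^ m) = y"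
      unfolding Z_set_def K by auto
    have y: "y \<noteq> 0" using nu_nonzero_imp_right_nonzero xy(1) z(2) by blast
    have "nu p (x / y) 1 = z" using nu_ratio[OF y] xy(1) by simp
    moreover have "(x / y) ^ (p ^ m) = x / y" using xy by (simp add: power_divide)
    ultimately show "(mv Z m :: 'a) = 0"
      using fixed_iff_mv_eq_0[OF p zp z(2,3)] by blast
  next
    assume mv: "(mv Z m :: 'a) = 0"
    obtain r where r: "r ^ p \<noteq> r" "nu p r 1 = z" using nu_attained[OF p] .
    have "r ^ (p ^ m) = r" using fixed_iff_mv_eq_0[OF p zp z(2,3) r(2)] mv by blast
    thus "z \<in> Z_set p m"
      unfolding Z_set_def K using r lin_indep_1[OF p r(1)] by force
  }
qed

text \<open>Needed for the roots of \<open>f_poly\<close>: a product over an infinite set would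
  default to 1.\<close>

lemma finite_Z_set:
  assumes p: "prime p" "CHAR('a :: alg_closed_field) = p" and m: "m \<ge> 1"
  shows "finite (Z_set p m :: 'a set)"
proof -
  let ?K = "{x :: 'a. x ^ (p ^ m) = x}"
  have "finite ?K" using card_power_fixed[OF p m] prime_gt_0_nat[OF p(1)]
    by (intro card_ge_0_finite) simp
  hence "finite ((\<lambda>(x, y). nu p x y) ` (?K \<times> ?K))" by blast
  moreover have "Z_set p m \<subseteq> (\<lambda>(x, y). nu p x y) ` (?K \<times> ?K)"
    unfolding Z_set_def subfield_of_order_eq[OF p m] by auto
  ultimately show ?thesis by (rule finite_subset[rotated])
qed

lemma f_poly_root_iff:
  fixes z :: "'a :: alg_closed_field"
  assumes p: "prime p" "CHAR('a) = p" and m: "m \<ge> 1"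
    and z: "z \<in> prime_field" "z \<noteq> 0" "of_int Z = z"
  shows "poly (f_poly m p) z = 0 \<longleftrightarrow> int p dvd poly (morgan_voyce m) Z"
proof -
  have "poly (f_poly m p) z = 0 \<longleftrightarrow> z \<in> Z_set p m - {0}"
    unfolding f_poly_def using finite_Z_set[OF p m] by (auto simp: poly_prod)
  thus ?thesis using mem_Z_set_iff[OF p m z] z(2) mv_eq_0_iff[OF p(2)] by auto
qed

section \<open>The bound \<open>p + 1\<close>\<close>

lemma mv_zero_le:
  fixes z :: "'a :: alg_closed_field"
  assumes p: "prime p" "CHAR('a) = p"
    and z: "z \<in> prime_field" "z \<noteq> 0" "of_int Z = z"
  shows "\<exists>m. 1 \<le> m \<and> m \<le> p + 1 \<and> (mv Z m :: 'a) = 0"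
proof -
  have p1: "p > 1" using p(1) by (rule prime_gt_1_nat)
  obtain s where s: "s ^ 2 = z" using nth_root_exists[of 2 z] by auto
  have s0: "s \<noteq> 0" using s z(2) by auto
  obtain a where "poly [:- 1, - s, 1:] a = 0"
    using alg_closed_imp_poly_has_root[of "[:- 1, - s, 1:]"] by auto
  hence a2: "a * a = s * a + 1" by (simp add: algebra_simps)
  define b where "b = s - a"
  have ab: "a * b = - 1" and b2: "b * b = s * b + 1"
    using a2 by (simp_all add: b_def algebra_simps)
  \<comment> \<open>The factor \<open>s\<close> at even indices evens out the alternation, giving
    constant coefficients.\<close>
  define G where "G n = (if even n then s else 1) * (mv Z n :: 'a)" for n
  have G_rec: "G (Suc (Suc n)) = s * G (Suc n) + G n" for n
    using z(3) s by (simp add: G_def mv_coeff_def algebra_simps power2_eq_square)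
  have G01: "G 0 = 0" "G (Suc 0) = 1" by (simp_all add: G_def)
  have G_iff: "G n = 0 \<longleftrightarrow> mv Z n = (0 :: 'a)" for n using s0 by (simp add: G_def)
  show ?thesis
  proof (cases "a = b")
    case True
    hence s2: "s = 2 * a" by (simp add: b_def)
    have aa: "a * a = - 1" using ab True by simp
    \<comment> \<open>Double root: \<open>G n\<close> is \<open>n * a ^ (n - 1)\<close>, multiplied
      by \<open>a\<close> to avoid the subtraction; it vanishes at \<open>n = p\<close>.\<close>
    have "a * G n = of_nat n * a ^ n \<and> a * G (Suc n) = of_nat (Suc n) * a ^ Suc n" for n
    proof (induction n)
      case (Suc n)
      have "a * G (Suc (Suc n)) = 2 * a * (a * G (Suc n)) + a * G n"
        by (simp add: G_rec s2 algebra_simps)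
      also have "\<dots> = 2 * (a * a) * of_nat (Suc n) * a ^ n + of_nat n * a ^ n"
        by (simp add: Suc.IH algebra_simps)
      also have "\<dots> = of_nat (Suc (Suc n)) * a ^ Suc (Suc n)"
      proof -
        have "a ^ Suc (Suc n) = - (a ^ n)" by (simp add: aa flip: mult.assoc)
        thus ?thesis by (simp only: aa) (simp add: algebra_simps)
      qed
      finally show ?case using Suc.IH by blast
    qed (simp_all add: G01)
    hence "a * G p = of_nat p * a ^ p" by blast
    also have "\<dots> = 0" using p(2) of_nat_CHAR[where ?'a = 'a] by simp
    finally have "G p = 0" using ab by auto
    thus ?thesis using p1 G_iff by (intro exI[of _ p]) auto
  next
    case False
    \<comment> \<open>Binet's formula for distinct roots.\<close>
    have "(a - b) * G n = a ^ n - b ^ n \<and> (a - b) * G (Suc n) = a ^ Suc n - b ^ Suc n" for n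
    proof (induction n)
      case (Suc n)
      have "(a - b) * G (Suc (Suc n)) = s * ((a - b) * G (Suc n)) + (a - b) * G n"
        by (simp add: G_rec algebra_simps)
      also have "\<dots> = s * (a ^ Suc n - b ^ Suc n) + (a ^ n - b ^ n)"
        by (simp only: Suc.IH)
      also have "\<dots> = (s * a + 1) * a ^ n - (s * b + 1) * b ^ n"
        by (simp add: algebra_simps)
      also have "\<dots> = a ^ Suc (Suc n) - b ^ Suc (Suc n)"
        unfolding a2[symmetric] b2[symmetric] by (simp add: mult.assoc)
      finally show ?case using Suc.IH by blast
    qed (simp_all add: G01)
    hence G: "G n = 0" if "a ^ n = b ^ n" for n
      using that False by (metis mult_eq_0_iff right_minus_eq)
    have nz: "a \<noteq> 0" "b \<noteq> 0" using ab by auto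
    \<comment> \<open>Frobenius fixes \<open>z\<close>, so it sends its square root \<open>s\<close>
      to \<open>s\<close> up to a sign \<open>e\<close>.\<close>
    have "(s ^ p) ^ 2 = s ^ 2"
      using prime_field_frobenius[OF p z(1)] s by (metis power_mult mult.commute)
    then obtain e where e: "s ^ p = e * s" "e * e = 1"
      by (metis power2_eq_iff mult_1 mult_minus1 minus_mult_minus)
    have e0: "e \<noteq> 0" using e(2) by auto
    have "a ^ p * b ^ p = (a * b) ^ p" by (simp add: power_mult_distrib)
    also have "\<dots> = (e * e) * (a * b)"
      using frobenius_minus[OF p, of 1 1] e(2) ab by simp
    finally have abp: "a ^ p * b ^ p = (e * a) * (e * b)" by (simp add: mult_ac)
    \<comment> \<open>\<open>a ^ p\<close> is a root of \<open>X^2 - e s X - 1\<close>, whose roots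
      are \<open>e * a\<close> and \<open>e * b\<close>.\<close>
    have "(a ^ p - e * a) * (a ^ p - e * b) = (a ^ p) * (a ^ p) - e * s * a ^ p + (e * e) * (a * b)"
      by (simp add: b_def algebra_simps)
    also have "\<dots> = (a * a) ^ p - (s * a) ^ p - 1"
      unfolding e(2) ab by (simp add: e(1)[symmetric] power_mult_distrib)
    also have "\<dots> = 0"
      using frobenius_add[OF p, of "s * a" 1 1] by (simp add: a2)
    finally have "a ^ p = e * a \<or> a ^ p = e * b" by (simp only: mult_eq_0_iff right_minus_eq)
    then consider "a ^ p = e * a" | "a ^ p = e * b" by blast
    then show ?thesis
    proof cases
      case 1
      hence bp: "b ^ p = e * b" using abp e0 nz by simp
      have "x ^ (p - 1) = e" if "x ^ p = e * x" "x \<noteq> 0" for x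
        using that p1 power_minus_mult[of p x] by simp
      hence "a ^ (p - 1) = b ^ (p - 1)" using 1 bp nz by metis
      hence "mv Z (p - 1) = (0 :: 'a)" using G G_iff by blast
      thus ?thesis using p1 by (intro exI[of _ "p - 1"]) auto
    next
      case 2
      hence bp: "b ^ p = e * a" using abp e0 nz by simp
      have "a ^ (p + 1) = b ^ (p + 1)" by (simp add: 2 bp)
      hence "mv Z (p + 1) = (0 :: 'a)" using G G_iff by blast
      thus ?thesis by (intro exI[of _ "p + 1"]) auto
    qed
  qed
qed

theorem theorem9p8:
  fixes p :: nat and z :: "'a :: alg_closed_field" and Z :: int
  assumes "prime p" and "CHAR('a) = p"
    and "algebraic_closure (ring_of_type_algebra :: 'a ring) prime_field"
    and "z \<in> prime_field" and "z \<noteq> 0" and "of_int Z = z"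
  shows "(\<exists>m\<ge>1. poly (f_poly m p) z = 0) \<and>
         1 \<le> alpha z p \<and> alpha z p \<le> p + 1 \<and>
         int p dvd poly (morgan_voyce (alpha z p)) Z \<and>
         (\<forall>m. 1 \<le> m \<and> m < alpha z p \<longrightarrow> \<not> int p dvd poly (morgan_voyce m) Z)"
proof -
  let ?P = "\<lambda>m. m \<ge> 1 \<and> poly (f_poly m p) z = 0"
  have root: "poly (f_poly m p) z = 0 \<longleftrightarrow> int p dvd poly (morgan_voyce m) Z" if "m \<ge> 1" for m
    using f_poly_root_iff[OF assms(1,2) that assms(4-6)] .
  \<comment> \<open>This witness both makes the \<open>LEAST\<close> in \<open>alpha\<close>
    meaningful and bounds it.\<close>
  obtain m where m: "1 \<le> m" "m \<le> p + 1" "(mv Z m :: 'a) = 0"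
    using mv_zero_le[OF assms(1,2,4-6)] by blast
  hence Pm: "?P m" using root mv_eq_0_iff[OF assms(2)] by blast
  have "?P (alpha z p)" unfolding alpha_def by (rule LeastI[of ?P, OF Pm])
  moreover have "alpha z p \<le> m" unfolding alpha_def by (rule Least_le[of ?P, OF Pm])
  moreover have "\<not> ?P k" if "k < alpha z p" for k
    using that unfolding alpha_def by (rule not_less_Least)
  ultimately show ?thesis using m Pm root by (meson order_trans)
qed

end
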